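(* Let $n,d$ be positive integers, let $A$ be a subgroup of $\mathbb Q^n$, and let $\mathbb Z^d\overset{\alpha}{\curvearrowright}A$ be a left action by group endomorphisms. If $d>1$, then $h_{alg}(\alpha)=0$.
   Context: A left action of a group $G$ on an abelian group $A$ assigns to each $g\in G$ an endomorphism $\alpha(g)$ of $A$ such that products in $G$ correspond to compositions and the neutral element acts as $\mathrm{id}_A$ (so $G$ acts by automorphisms). A right Følner net of an amenable group $G$ is a net $(F_i)_{i\in I}$ of non-empty finite subsets of $G$ with $\lim_{i\in I}|F_ig\setminus F_i|/|F_i|=0$ for every $g\in G$. For non-empty finite $X\subseteq A$ and non-empty finite $F\subseteq G$ put $T_F(\alpha,X)=\sum_{g\in F}\alpha(g)(X)$ (sum of subsets). Set $H_{alg}(\alpha,X)=\lim_{i\in I}\frac{\log|T_{F_i}(\alpha,X)|}{|F_i|}$ for any right Følner net $(F_i)_{i\in I}$ of $G$; the limit is known to exist, to be finite, and not to depend on the net. Define $h_{alg}(\alpha)=\sup\{H_{alg}(\alpha,X):X\subseteq A\text{ non-empty finite}\}\in[0,\infty]$. *)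

theory Defs
  imports "HOL-Analysis.Analysis" "HOL-Library.Set_Algebras"
begin

definition additive_subgroup_set :: "'a::ab_group_add set \<Rightarrow> bool" where
  "additive_subgroup_set A \<longleftrightarrow>
     0 \<in> A \<and> (\<forall>x\<in>A. \<forall>y\<in>A. x + y \<in> A) \<and> (\<forall>x\<in>A. - x \<in> A)"

(* Groups are written additively. Only the values of \<alpha> g on A matter; nothing is
   assumed about \<alpha> g outside A. *)
definition left_action_on :: "'a::ab_group_add set \<Rightarrow> ('g::group_add \<Rightarrow> 'a \<Rightarrow> 'a) \<Rightarrow> bool" where
  "left_action_on A \<alpha> \<longleftrightarrow>
     (\<forall>g. \<forall>x\<in>A. \<alpha> g x \<in> A) \<and>
     (\<forall>g. \<forall>x\<in>A. \<forall>y\<in>A. \<alpha> g (x + y) = \<alpha> g x + \<alpha> g y) \<and>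
     (\<forall>g h. \<forall>x\<in>A. \<alpha> (g + h) x = \<alpha> g (\<alpha> h x)) \<and>
     (\<forall>x\<in>A. \<alpha> 0 x = x)"

(* A net (F i) is rendered, as usual in the library, by a family F together with a proper
   filter N on the index type (for a directed index set: the filter of its tails). *)
definition right_folner_net :: "('i \<Rightarrow> 'g::group_add set) \<Rightarrow> 'i filter \<Rightarrow> bool" where
  "right_folner_net F N \<longleftrightarrow>
     N \<noteq> bot \<and>
     (\<forall>\<^sub>F i in N. finite (F i) \<and> F i \<noteq> {}) \<and>
     (\<forall>g. ((\<lambda>i. real (card ((\<lambda>x. x + g) ` F i - F i)) / real (card (F i))) \<longlongrightarrow> 0) N)"

(* The sum is the elementwise (Minkowski) sum of sets from Set_Algebras. *)
definition trajectory :: "('g \<Rightarrow> 'a::ab_group_add \<Rightarrow> 'a) \<Rightarrow> 'a set \<Rightarrow> 'g set \<Rightarrow> 'a set" where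
  "trajectory \<alpha> X F = (\<Sum>g\<in>F. \<alpha> g ` X)"

(* The common limit along all right Folner nets. One cannot quantify over index types, but a
   Folner net (F, N) matters only through the filter "filtermap F N" on 'g set, so
   all nets are covered by filters on 'g set with the identity family; see the
   two lemmas below. *)
definition H_alg :: "('g::group_add \<Rightarrow> 'a::ab_group_add \<Rightarrow> 'a) \<Rightarrow> 'a set \<Rightarrow> real" where
  "H_alg \<alpha> X = (THE L. \<forall>N. right_folner_net (\<lambda>F. F) N \<longrightarrow>
     ((\<lambda>F. ln (real (card (trajectory \<alpha> X F))) / real (card F)) \<longlongrightarrow> L) N)"

lemma right_folner_net_filtermap:
  "right_folner_net (\<lambda>E. E) (filtermap F N) \<longleftrightarrow> right_folner_net F N"
  by (simp add: right_folner_net_def eventually_filtermap filterlim_filtermap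
      filtermap_bot_iff)

lemma folner_limit_all_nets:
  fixes F :: "'i \<Rightarrow> 'g::group_add set" and f :: "'g set \<Rightarrow> real"
  assumes "\<And>N. right_folner_net (\<lambda>E. E) N \<Longrightarrow> (f \<longlongrightarrow> L) N"
    and "right_folner_net F N"
  shows "((\<lambda>i. f (F i)) \<longlongrightarrow> L) N"
  using assms(1)[of "filtermap F N"] assms(2)
  by (simp add: right_folner_net_filtermap filterlim_filtermap)

definition h_alg :: "'a::ab_group_add set \<Rightarrow> ('g::group_add \<Rightarrow> 'a \<Rightarrow> 'a) \<Rightarrow> ereal" where
  "h_alg A \<alpha> = (SUP X\<in>{X. X \<subseteq> A \<and> finite X \<and> X \<noteq> {}}. ereal (H_alg \<alpha> X))"

end

(* The function F |-> log |T_F(X)| is subadditive on disjoint unions and does not increase under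
   translation, so along a Folner net its density is at most its value on any translational tile B
   divided by |B|. For a k x k square B spanned by two coordinate directions of Z^d, each generator
   acts on A through a rational matrix, hence multiplies denominators and numerators by bounded
   factors; so T_B(X) lies among the rational vectors with one fixed denominator and numerators of
   size exp(O(k)), which gives log |T_B(X)| = O(k), whereas |B| = k^2. *)
theory Submission
  imports Defs
begin

text \<open>An endomorphism of \<open>A\<close> is given only on \<open>A\<close>, and
  \<open>A\<close> may be far from finitely generated (all of Q^n is allowed), so integral bases
  cannot describe it. Over Q it is linear: the values on a maximal independent subset of
  \<open>A\<close> determine it once denominators are cleared, and a rational matrix gives the
  height bounds. Minkowski sums of vectors with unrelated denominators would be hard to count. All
  summands over a tile are therefore brought to one denominator before adding; then only numerator
  bounds add up, and k^2 summands cost no more than a factor k^2. Because log |T_F(X)| is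
  nonnegative, an upper bound below every e > 0, eventually along an arbitrary net, already proves
  convergence to 0. In a single direction the same estimate would compare O(k) with |B| = k and give
  only finiteness; doubling on the integers indeed has positive entropy.\<close>

section \<open>Cardinality of coordinate boxes\<close>

lemma vec_box_eq: "{x :: 'a ^ 'n. \<forall>i. x $ i \<in> S i} = vec_lambda ` PiE UNIV S"
proof -
  have "x \<in> vec_lambda ` PiE UNIV S" if "\<forall>i. x $ i \<in> S i" for x :: "'a ^ 'n"
    using that by (intro image_eqI[of _ _ "vec_nth x"]) auto
  then show ?thesis by auto
qed

lemma card_vec_box: "card {x :: 'a ^ 'n. \<forall>i. x $ i \<in> S i} = (\<Prod>i\<in>UNIV. card (S i))"
proof -
  have "inj_on vec_lambda (PiE UNIV S)"
    by (rule inj_onI) (simp add: vec_lambda_inject)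
  then show ?thesis by (simp add: vec_box_eq card_image card_PiE)
qed

lemma finite_vec_box:
  "(\<And>i. finite (S i)) \<Longrightarrow> finite {x :: 'a ^ 'n. \<forall>i. x $ i \<in> S i}"
  by (simp add: vec_box_eq finite_PiE)

section \<open>Additive maps on subgroups of Q^n are rational matrices\<close>

lemma additive_on_int_scale:
  fixes A :: "(rat ^ 'n) set" and f :: "rat ^ 'n \<Rightarrow> rat ^ 'm"
  assumes A: "additive_subgroup_set A"
    and add: "\<And>x y. x \<in> A \<Longrightarrow> y \<in> A \<Longrightarrow> f (x + y) = f x + f y"
    and x: "x \<in> A"
  shows "of_int k *s x \<in> A \<and> f (of_int k *s x) = of_int k *s f x"
proof -
  have zero: "0 \<in> A" and plus: "\<And>x y. x \<in> A \<Longrightarrow> y \<in> A \<Longrightarrow> x + y \<in> A"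
    and minus: "\<And>x. x \<in> A \<Longrightarrow> - x \<in> A"
    using A by (auto simp: additive_subgroup_set_def)
  have f0: "f 0 = 0" using add[OF zero zero] by simp
  have fminus: "f (- y) = - f y" if "y \<in> A" for y
    using add[OF that minus[OF that]] f0 by (simp add: eq_neg_iff_add_eq_0 add.commute)
  have nat: "of_nat m *s x \<in> A \<and> f (of_nat m *s x) = of_nat m *s f x" for m
  proof (induction m)
    case 0 show ?case using zero f0 by simp
  next
    case (Suc m)
    then show ?case using plus[OF x] add[OF x] by (simp add: vec.scale_left_distrib)
  qed
  show ?thesis
  proof (cases k)
    case (nonneg m) then show ?thesis using nat[of m] by simp
  next
    case (neg m)
    have "of_int k *s x = - (of_nat (Suc m) *s x)" "of_int k *s f x = - (of_nat (Suc m) *s f x)"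
      unfolding neg by (simp_all only: of_int_minus of_int_of_nat_eq vec.scale_minus_left)
    then show ?thesis using nat[of "Suc m"] minus fminus by metis
  qed
qed

text \<open>A maximal independent subset \<open>B\<close> of \<open>A\<close> spans \<open>A\<close>
  over Q. The linear extension \<open>g\<close> of \<open>f\<close> restricted to \<open>B\<close>
  agrees with \<open>f\<close> on a positive integer multiple of every vector of the span, and the
  multiple cancels because the target is a vector space over Q.\<close>

lemma additive_on_eq_matrix:
  fixes A :: "(rat ^ 'n) set" and f :: "rat ^ 'n \<Rightarrow> rat ^ 'm"
  assumes A: "additive_subgroup_set A"
    and add: "\<And>x y. x \<in> A \<Longrightarrow> y \<in> A \<Longrightarrow> f (x + y) = f x + f y"
  obtains M :: "rat ^ 'n ^ 'm" where "\<And>x. x \<in> A \<Longrightarrow> f x = M *v x"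
proof -
  obtain B where B: "B \<subseteq> A" "vec.independent B" "A \<subseteq> vec.span B"
    by (rule vec.maximal_independent_subset)
  obtain g where g: "Vector_Spaces.linear (*s) (*s) g" and gB: "\<And>x. x \<in> B \<Longrightarrow> g x = f x"
    using vec.linear_independent_extend[OF B(2)] by blast
  interpret g: Vector_Spaces.linear "(*s)" "(*s)" g by fact
  have zero: "0 \<in> A" and plus: "\<And>x y. x \<in> A \<Longrightarrow> y \<in> A \<Longrightarrow> x + y \<in> A"
    using A by (auto simp: additive_subgroup_set_def)
  have scale: "of_int k *s x \<in> A" "f (of_int k *s x) = of_int k *s f x" if "x \<in> A" for k x
    using additive_on_int_scale[OF A add that] by auto
  \<comment> \<open>The induction over the span leaves \<open>A\<close>, where \<open>f\<close> is
    not controlled; agreement is therefore asserted only for some positive multiple that lies in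
    \<open>A\<close>.\<close>
  let ?h = "\<lambda>y. \<exists>N>0. of_int N *s y \<in> A \<and> f (of_int N *s y) = g (of_int N *s y)"
  have h: "?h y" if "y \<in> vec.span B" for y
    using that
  proof (induction rule: vec.span_induct_alt)
    case base
    show ?case using zero add[OF zero zero] g.zero by (intro exI[of _ 1]) simp
  next
    case (step c x y)
    then obtain N where N: "N > 0" "of_int N *s y \<in> A"
      "f (of_int N *s y) = g (of_int N *s y)" by blast
    obtain p q where pq: "c = of_int p / of_int q" "q > 0"
      using quotient_of_div[of c] quotient_of_denom_pos[of c] by (cases "quotient_of c") auto
    \<comment> \<open>\<open>N\<close> clears the denominator for \<open>y\<close> and
      \<open>q\<close> that of \<open>c\<close>, so the right side is an integer combination of the
      elements \<open>x\<close> and \<open>N y\<close> of \<open>A\<close>.\<close>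
    have eq: "of_int (N * q) *s (c *s x + y) = of_int (N * p) *s x + of_int q *s (of_int N *s y)"
      using pq by (simp add: vec_eq_iff field_simps)
    have xA: "x \<in> A" using step B by blast
    note s = scale[OF xA, of "N * p"] scale[OF N(2), of q]
    have "of_int (N * q) *s (c *s x + y) \<in> A" unfolding eq by (intro plus s)
    moreover have "f (of_int (N * q) *s (c *s x + y)) = g (of_int (N * q) *s (c *s x + y))"
      unfolding eq add[OF s(1) s(3)] s(2,4) g.add g.scale gB[OF step(1)] N(3) ..
    ultimately show ?case using N(1) pq(2) by (intro exI[of _ "N * q"]) simp
  qed
  have "f x = g x" if x: "x \<in> A" for x
  proof -
    obtain N where N: "N > 0" "f (of_int N *s x) = g (of_int N *s x)" using h x B(3) by blast
    have "of_int N *s f x = of_int N *s g x" using scale(2)[OF x, of N] N(2) g.scale by metis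
    then show ?thesis using N(1) by simp
  qed
  then show ?thesis using that[of "matrix g"] matrix_works[OF g] by metis
qed

section \<open>Rational vectors with a common denominator and bounded numerators\<close>

text \<open>\<open>N\<close> is any common denominator, not the lowest one. Fixing it makes sums
  harmless: the denominator stays and the numerator bounds add.\<close>

definition height_box :: "int \<Rightarrow> int \<Rightarrow> (rat ^ 'n) set" where
  "height_box N c = {x. \<forall>i. \<exists>z. \<bar>z\<bar> \<le> c \<and> of_int N * x $ i = of_int z}"

lemma height_boxE:
  assumes "x \<in> height_box N c"
  obtains z where "\<And>i. \<bar>z i\<bar> \<le> c" "\<And>i. of_int N * x $ i = of_int (z i)"
proof -
  have "\<forall>i. \<exists>z. \<bar>z\<bar> \<le> c \<and> of_int N * x $ i = of_int z"
    using assms by (simp add: height_box_def)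
  from choice[OF this] show ?thesis using that by blast
qed

lemma height_box_subset_image:
  assumes "N \<noteq> 0"
  shows "(height_box N c :: (rat ^ 'n) set) \<subseteq>
    (\<lambda>z. \<chi> i. of_int (z $ i) / of_int N) ` {z :: int ^ 'n. \<forall>i. z $ i \<in> {-c..c}}"
proof
  fix x :: "rat ^ 'n" assume "x \<in> height_box N c"
  then obtain z where z: "\<And>i. \<bar>z i\<bar> \<le> c" "\<And>i. of_int N * x $ i = of_int (z i)"
    by (rule height_boxE) (rule that, auto)
  have "x = (\<chi> i. of_int ((vec_lambda z) $ i) / of_int N)"
    using assms by (simp add: vec_eq_iff flip: z(2))
  moreover have "vec_lambda z \<in> {z. \<forall>i. z $ i \<in> {-c..c}}"
    using z(1) by (auto simp: abs_le_iff minus_le_iff)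
  ultimately show "x \<in> (\<lambda>z. \<chi> i. of_int (z $ i) / of_int N) ` {z :: int ^ 'n. \<forall>i. z $ i \<in> {-c..c}}"
    by blast
qed

text \<open>For a nonzero denominator a vector is determined by its numerators, and each of them
  ranges over the integers from \<open>-c\<close> to \<open>c\<close>.\<close>

lemma
  assumes "N \<noteq> 0"
  shows finite_height_box: "finite (height_box N c :: (rat ^ 'n) set)"
    and card_height_box: "card (height_box N c :: (rat ^ 'n) set) \<le> nat (2 * c + 1) ^ CARD('n)"
proof -
  let ?B = "{z :: int ^ 'n. \<forall>i. z $ i \<in> {-c..c}}"
  have fin: "finite ?B" by (rule finite_vec_box) simp
  show "finite (height_box N c :: (rat ^ 'n) set)"
    using height_box_subset_image[OF assms] fin by (rule finite_surj[rotated])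
  have "card (height_box N c :: (rat ^ 'n) set) \<le> card ?B"
    using height_box_subset_image[OF assms] fin by (rule surj_card_le[rotated])
  also have "card ?B = nat (2 * c + 1) ^ CARD('n)" unfolding card_vec_box by simp
  finally show "card (height_box N c :: (rat ^ 'n) set) \<le> nat (2 * c + 1) ^ CARD('n)" .
qed

lemma height_box_add:
  assumes "x \<in> height_box N c" "y \<in> height_box N c'"
  shows "x + y \<in> height_box N (c + c')"
  unfolding height_box_def
proof safe
  fix i
  obtain z w where "\<bar>z\<bar> \<le> c" "of_int N * x $ i = of_int z" "\<bar>w\<bar> \<le> c'" "of_int N * y $ i = of_int w"
    using assms unfolding height_box_def by blast
  then show "\<exists>z. \<bar>z\<bar> \<le> c + c' \<and> of_int N * (x + y) $ i = of_int z"
    by (intro exI[of _ "z + w"]) (simp add: algebra_simps)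
qed

lemma height_box_sum:
  assumes "finite F" "\<And>g. g \<in> F \<Longrightarrow> S g \<subseteq> height_box N c"
  shows "(\<Sum>g\<in>F. S g) \<subseteq> height_box N (int (card F) * c)"
  using assms
proof (induction F rule: finite_induct)
  case empty
  show ?case by (auto simp: height_box_def)
next
  case (insert g F)
  then have "x + y \<in> height_box N (c + int (card F) * c)"
    if "x \<in> S g" "y \<in> (\<Sum>g\<in>F. S g)" for x y
    using that by (intro height_box_add) auto
  then show ?case using insert(1,2) by (auto simp: algebra_simps elim!: set_plus_elim)
qed

text \<open>Passing to a finer denominator multiplies numerators by \<open>D\<close>. This serves to
  bring images under different numbers of generator steps to one denominator.\<close>

lemma height_box_mono:
  assumes "x \<in> height_box N c" "D > 0" "D * c \<le> c'"
  shows "x \<in> height_box (N * D) c'"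
  unfolding height_box_def
proof safe
  fix i
  obtain z where z: "\<bar>z\<bar> \<le> c" "of_int N * x $ i = of_int z"
    using assms unfolding height_box_def by blast
  have "\<bar>D * z\<bar> \<le> D * c" using z(1) assms(2) by (simp add: abs_mult)
  then show "\<exists>z. \<bar>z\<bar> \<le> c' \<and> of_int (N * D) * x $ i = of_int z"
    using z assms(3) by (intro exI[of _ "D * z"]) (simp add: algebra_simps)
qed

lemma common_denominator:
  fixes r :: "'i \<Rightarrow> rat"
  assumes "finite I"
  obtains D z where "D > 0" "\<And>i. i \<in> I \<Longrightarrow> of_int D * r i = of_int (z i)"
proof -
  define q where "q i = snd (quotient_of (r i))" for i
  define p where "p i = fst (quotient_of (r i))" for i
  have q: "q i > 0" "of_int (q i) * r i = of_int (p i)" for i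
  proof -
    have *: "quotient_of (r i) = (p i, q i)" by (simp add: p_def q_def)
    show "q i > 0" using quotient_of_denom_pos[OF *] .
    then show "of_int (q i) * r i = of_int (p i)" using quotient_of_div[OF *] by simp
  qed
  have "of_int (prod q I) * r i = of_int (p i * prod q (I - {i}))" if "i \<in> I" for i
  proof -
    have "of_int (prod q I) * r i = of_int (prod q (I - {i})) * (of_int (q i) * r i)"
      using prod.remove[OF assms that, of q] by simp
    then show ?thesis unfolding q(2) by simp
  qed
  moreover have "prod q I > 0" using q(1) by (simp add: prod_pos)
  ultimately show ?thesis by (rule that[rotated])
qed

lemma matrix_height_box:
  fixes M :: "rat ^ 'n ^ 'm"
  obtains D K where "D > 0" "K \<ge> 0"
    "\<And>N c x. x \<in> height_box N c \<Longrightarrow> M *v x \<in> height_box (N * D) (K * c)"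
proof -
  obtain D z where D: "D > 0" and z: "\<And>i. of_int D * (M $ fst i $ snd i) = of_int (z i)"
    using common_denominator[of UNIV "\<lambda>i. M $ fst i $ snd i"] by auto
  \<comment> \<open>The sum over all entries is a crude bound for the absolute sum of every single
    row.\<close>
  define K where "K = (\<Sum>i\<in>UNIV. \<bar>z i\<bar>)"
  have "M *v x \<in> height_box (N * D) (K * c)" if x: "x \<in> height_box N c" for N c x
    unfolding height_box_def
  proof safe
    fix i
    obtain w where w: "\<And>j. \<bar>w j\<bar> \<le> c" "\<And>j. of_int N * x $ j = of_int (w j)"
      using x by (rule height_boxE) (rule that, auto)
    \<comment> \<open>\<open>undefined\<close> is just some index: any coordinate shows that the
      bound \<open>c\<close> cannot be negative.\<close>
    have c: "c \<ge> 0" using w(1)[of undefined] by linarith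
    have "of_int (N * D) * (M *v x) $ i
        = (\<Sum>j\<in>UNIV. (of_int D * (M $ i $ j)) * (of_int N * x $ j))"
      by (simp add: matrix_vector_mult_def sum_distrib_left algebra_simps)
    also have "\<dots> = of_int (\<Sum>j\<in>UNIV. z (i, j) * w j)"
      using z[of "(i, _)"] by (simp add: w(2))
    finally have 1: "of_int (N * D) * (M *v x) $ i = of_int (\<Sum>j\<in>UNIV. z (i, j) * w j)" .
    have "\<bar>\<Sum>j\<in>UNIV. z (i, j) * w j\<bar> \<le> (\<Sum>j\<in>UNIV. \<bar>z (i, j)\<bar> * c)"
      by (rule order_trans[OF sum_abs]) (auto intro!: sum_mono mult_left_mono simp: abs_mult w(1))
    also have "\<dots> = (\<Sum>p\<in>Pair i ` UNIV. \<bar>z p\<bar>) * c"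
      by (simp add: sum_distrib_right sum.reindex inj_on_def)
    also have "\<dots> \<le> K * c" unfolding K_def using c by (intro mult_right_mono sum_mono2) auto
    finally show "\<exists>y. \<bar>y\<bar> \<le> K * c \<and> of_int (N * D) * (M *v x) $ i = of_int y" using 1 by blast
  qed
  moreover have "K \<ge> 0" unfolding K_def by (simp add: sum_nonneg)
  ultimately show ?thesis using that D by blast
qed

lemma finite_subset_height_box:
  fixes X :: "(rat ^ 'n) set"
  assumes "finite X"
  obtains N c where "N > 0" "c > 0" "X \<subseteq> height_box N c"
proof -
  obtain N z where N: "N > 0"
    and z: "\<And>p. p \<in> X \<times> UNIV \<Longrightarrow> of_int N * (fst p $ snd p) = of_int (z p)"
    using common_denominator[of "X \<times> UNIV" "\<lambda>p. fst p $ snd p"] assms by auto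
  \<comment> \<open>The summand 1 keeps \<open>c\<close> positive even if all numerators vanish, so
    that its logarithm can be taken later.\<close>
  define c where "c = 1 + (\<Sum>p\<in>X \<times> UNIV. \<bar>z p\<bar>)"
  have "x \<in> height_box N c" if "x \<in> X" for x
    unfolding height_box_def
  proof safe
    fix i
    have "\<bar>z (x, i)\<bar> \<le> (\<Sum>p\<in>X \<times> UNIV. \<bar>z p\<bar>)"
      using that assms by (intro member_le_sum) auto
    then have "\<bar>z (x, i)\<bar> \<le> c" by (simp add: c_def)
    then show "\<exists>y. \<bar>y\<bar> \<le> c \<and> of_int N * x $ i = of_int y" using z[of "(x, i)"] that by auto
  qed
  moreover have "c > 0" unfolding c_def by (simp add: sum_nonneg add_pos_nonneg)
  ultimately show ?thesis using that N by blast
qed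

section \<open>Subadditive set functions, tilings and Folner nets\<close>

lemma card_set_plus_le:
  assumes "finite S" "finite T"
  shows "card (S + T) \<le> card S * card T"
  using card_image_le[of "S \<times> T" "\<lambda>(x, y). x + y"] assms
  by (simp add: set_plus_image card_cartesian_product)

text \<open>An Ornstein--Weiss type estimate: the translates of the tile \<open>B\<close> that lie inside \<open>F\<close> are
  counted by \<open>card F / card B\<close>, while the points of \<open>F\<close> in any other translate are moved out of
  \<open>F\<close> by a difference of two elements of \<open>B\<close>.\<close>
lemma tiling_bound:
  fixes f :: "'g::ab_group_add set \<Rightarrow> real" and p :: "'g \<Rightarrow> 'g"
  assumes empty: "f {} \<le> 0"
    and Un: "\<And>F F'. finite F \<Longrightarrow> finite F' \<Longrightarrow> F \<inter> F' = {} \<Longrightarrow> f (F \<union> F') \<le> f F + f F'"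
    and shift: "\<And>t. f ((+) t ` B) \<le> f B"
    and single: "\<And>g. f {g} \<le> M"
    and B: "finite B" "B \<noteq> {}" "0 \<le> f B" and M: "0 \<le> M"
    and p_tile: "\<And>g. g - p g \<in> B" and p_unique: "\<And>g b. b \<in> B \<Longrightarrow> p (p g + b) = p g"
    and F: "finite F"
  shows "f F \<le> real (card F) * (f B / real (card B))
    + M * (\<Sum>h\<in>(\<lambda>(a, b). a - b) ` (B \<times> B). real (card ((\<lambda>x. x + h) ` F - F)))"
proof -
  \<comment> \<open>\<open>p g\<close> is the base point of the tile containing \<open>g\<close>;
    \<open>U\<close> collects the points whose whole tile lies in \<open>F\<close>.\<close>
  define U where "U = {g \<in> F. (+) (p g) ` B \<subseteq> F}"
  define W where "W = F - U"
  have fin: "finite U" "finite W" using F by (auto simp: U_def W_def)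
  have tiles: "f (\<Union>t\<in>T. (+) t ` B) \<le> real (card T) * f B
      \<and> card (\<Union>t\<in>T. (+) t ` B) = card T * card B"
    if "finite T" "T \<subseteq> range p" for T
    using that
  proof (induction T rule: finite_induct)
    case empty
    then show ?case using assms(1) by simp
  next
    case (insert t T)
    \<comment> \<open>\<open>p\<close> recovers the base point from any point of a tile, so tiles
      that meet have the same base point.\<close>
    have disj: "(+) t ` B \<inter> (\<Union>t\<in>T. (+) t ` B) = {}"
    proof (rule ccontr)
      assume "\<not> ?thesis"
      then obtain b t' b' where *: "b \<in> B" "t' \<in> T" "b' \<in> B" "t + b = t' + b'" by auto
      obtain g g' where "t = p g" "t' = p g'" using insert.prems *(2) by auto
      then have "t = t'" using p_unique[OF *(1), of g] p_unique[OF *(3), of g'] *(4) by simp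
      then show False using *(2) insert.hyps by simp
    qed
    have fins: "finite ((+) t ` B)" "finite (\<Union>t\<in>T. (+) t ` B)" using B(1) insert.hyps by auto
    have eq: "(\<Union>t\<in>insert t T. (+) t ` B) = (+) t ` B \<union> (\<Union>t\<in>T. (+) t ` B)" by simp
    show ?case
      unfolding eq using Un[OF fins disj] card_Un_disjoint[OF fins disj] shift[of t] insert
      by (simp add: card_image algebra_simps)
  qed
  have U_eq: "U = (\<Union>t\<in>p ` U. (+) t ` B)"
  proof
    show "U \<subseteq> (\<Union>t\<in>p ` U. (+) t ` B)"
    proof
      fix g assume "g \<in> U"
      moreover have "g \<in> (+) (p g) ` B" using p_tile[of g] by (intro image_eqI[of _ _ "g - p g"]) auto
      ultimately show "g \<in> (\<Union>t\<in>p ` U. (+) t ` B)" by blast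
    qed
    show "(\<Union>t\<in>p ` U. (+) t ` B) \<subseteq> U"
    proof
      fix x assume "x \<in> (\<Union>t\<in>p ` U. (+) t ` B)"
      then obtain g b where g: "g \<in> U" "b \<in> B" "x = p g + b" by auto
      then show "x \<in> U" using p_unique[OF g(2), of g] by (auto simp: U_def)
    qed
  qed
  have cB: "card B > 0" using B by (simp add: card_gt_0_iff)
  have "f U \<le> real (card (p ` U)) * f B" "card U = card (p ` U) * card B"
    using tiles[of "p ` U"] fin U_eq by auto
  then have "f U \<le> real (card U) * (f B / real (card B))" using cB by simp
  \<comment> \<open>Replacing \<open>U\<close> by the larger \<open>F\<close> uses that
    \<open>f B\<close> is nonnegative.\<close>
  also have "\<dots> \<le> real (card F) * (f B / real (card B))"
    using F B(3) by (intro mult_right_mono) (auto simp: U_def intro!: card_mono)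
  finally have fU: "f U \<le> real (card F) * (f B / real (card B))" .
  have fS: "f S \<le> M * real (card S)" if "finite S" for S
    using that
  proof (induction S rule: finite_induct)
    case empty
    then show ?case using assms(1) by simp
  next
    case (insert g S)
    then show ?case using Un[of "{g}" S] single[of g] by (simp add: algebra_simps)
  qed
  let ?D = "(\<lambda>(a, b). a - b) ` (B \<times> B)"
  \<comment> \<open>A point \<open>g\<close> of \<open>W\<close> has a point \<open>p g + b\<close>
    of its tile outside \<open>F\<close>. The displacement \<open>h = b - (g - p g)\<close> is a
    difference of two elements of \<open>B\<close>, and \<open>g + h\<close> lies in
    \<open>F + h\<close> but not in \<open>F\<close>.\<close>
  have "W \<subseteq> (\<Union>h\<in>?D. (\<lambda>x. x - h) ` ((\<lambda>x. x + h) ` F - F))"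
  proof
    fix g assume "g \<in> W"
    then obtain b where b: "g \<in> F" "b \<in> B" "p g + b \<notin> F" by (auto simp: W_def U_def)
    let ?h = "b - (g - p g)"
    have "g + ?h = p g + b" by simp
    then have "g + ?h \<in> (\<lambda>x. x + ?h) ` F - F" using b by (metis DiffI imageI)
    moreover have "g = (g + ?h) - ?h" by simp
    ultimately have "g \<in> (\<lambda>x. x - ?h) ` ((\<lambda>x. x + ?h) ` F - F)" by (rule image_eqI[rotated])
    moreover have "?h \<in> ?D" using b(2) p_tile by blast
    ultimately show "g \<in> (\<Union>h\<in>?D. (\<lambda>x. x - h) ` ((\<lambda>x. x + h) ` F - F))" by blast
  qed
  then have "card W \<le> card (\<Union>h\<in>?D. (\<lambda>x. x - h) ` ((\<lambda>x. x + h) ` F - F))"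
    using B(1) F by (intro card_mono) auto
  also have "\<dots> \<le> (\<Sum>h\<in>?D. card ((\<lambda>x. x - h) ` ((\<lambda>x. x + h) ` F - F)))"
    using B(1) by (intro card_UN_le) auto
  also have "\<dots> = (\<Sum>h\<in>?D. card ((\<lambda>x. x + h) ` F - F))"
    by (intro sum.cong refl card_image) (simp add: inj_on_def)
  finally have "real (card W) \<le> (\<Sum>h\<in>?D. real (card ((\<lambda>x. x + h) ` F - F)))"
    by (metis of_nat_le_iff of_nat_sum)
  then have "f W \<le> M * (\<Sum>h\<in>?D. real (card ((\<lambda>x. x + h) ` F - F)))"
    using fS[OF fin(2)] M mult_left_mono order_trans by blast
  moreover have "f F \<le> f U + f W"
  proof -
    have "U \<inter> W = {}" "U \<union> W = F" by (auto simp: W_def U_def)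
    then show ?thesis using Un[OF fin] by simp
  qed
  ultimately show ?thesis using fU by linarith
qed

text \<open>For a fixed tile the error in \<open>tiling_bound\<close> is a finite sum of boundary
  terms, each of which, divided by \<open>card F\<close>, tends to 0 by the Folner condition. Hence
  the upper limit is at most \<open>f B / card B\<close>, which can be made arbitrarily
  small.\<close>

lemma folner_limit_zero:
  fixes f :: "'g::ab_group_add set \<Rightarrow> real"
  assumes N: "right_folner_net (\<lambda>F. F) N"
    and nonneg: "\<And>F. finite F \<Longrightarrow> 0 \<le> f F"
    and empty: "f {} \<le> 0"
    and Un: "\<And>F F'. finite F \<Longrightarrow> finite F' \<Longrightarrow> F \<inter> F' = {} \<Longrightarrow> f (F \<union> F') \<le> f F + f F'"
    and shift: "\<And>F t. finite F \<Longrightarrow> f ((+) t ` F) \<le> f F"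
    and tile: "\<And>e. e > 0 \<Longrightarrow> \<exists>B p. finite B \<and> B \<noteq> {} \<and> f B / real (card B) < e \<and>
      (\<forall>g. g - p g \<in> B) \<and> (\<forall>g. \<forall>b\<in>B. p (p g + b) = p g)"
  shows "((\<lambda>F. f F / real (card F)) \<longlongrightarrow> 0) N"
proof (rule order_tendstoI)
  have ev: "\<forall>\<^sub>F F in N. finite F \<and> F \<noteq> {}" using N by (simp add: right_folner_net_def)
  fix a :: real assume "a < 0"
  show "\<forall>\<^sub>F F in N. a < f F / real (card F)"
    using ev
  proof (rule eventually_mono)
    fix F :: "'g set" assume "finite F \<and> F \<noteq> {}"
    then have "0 \<le> f F / real (card F)" using nonneg by simp
    then show "a < f F / real (card F)" using \<open>a < 0\<close> by linarith
  qed
next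
  have ev: "\<forall>\<^sub>F F in N. finite F \<and> F \<noteq> {}" using N by (simp add: right_folner_net_def)
  fix e :: real assume "0 < e"
  then obtain B p where B: "finite B" "B \<noteq> {}" "f B / real (card B) < e"
    and p: "\<And>g. g - p g \<in> B" "\<And>g b. b \<in> B \<Longrightarrow> p (p g + b) = p g"
    using tile[of e] by blast
  let ?D = "(\<lambda>(a, b). a - b) ` (B \<times> B)"
  \<comment> \<open>All singletons are translates of \<open>{0}\<close>, so its value bounds
    theirs.\<close>
  define M where "M = f {0}"
  have M: "0 \<le> M" using nonneg by (simp add: M_def)
  have single: "f {g} \<le> M" for g using shift[of "{0}" g] by (simp add: M_def)
  let ?u = "\<lambda>F. f B / real (card B)
    + M * (\<Sum>h\<in>?D. real (card ((\<lambda>x. x + h) ` F - F)) / real (card F))"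
  have "(?u \<longlongrightarrow> f B / real (card B) + M * (\<Sum>h\<in>?D. 0)) N"
    using N by (intro tendsto_intros) (simp add: right_folner_net_def)
  then have "\<forall>\<^sub>F F in N. ?u F < e" using B(3) by (intro order_tendstoD(2)) auto
  with ev show "\<forall>\<^sub>F F in N. f F / real (card F) < e"
  proof eventually_elim
    case (elim F)
    have "card F > 0" using elim by (simp add: card_gt_0_iff)
    have "f F \<le> real (card F) * (f B / real (card B))
      + M * (\<Sum>h\<in>?D. real (card ((\<lambda>x. x + h) ` F - F)))"
      using elim by (intro tiling_bound[where p = p] empty Un shift single B nonneg M p) auto
    also have "\<dots> = real (card F) * ?u F"
      using \<open>card F > 0\<close> by (simp add: distrib_left sum_divide_distrib[symmetric])
    finally have "f F / real (card F) \<le> ?u F"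
      using \<open>card F > 0\<close> by (simp add: divide_le_eq mult.commute)
    then show ?case using elim by linarith
  qed
qed

section \<open>Existence of a Folner net in Z^d\<close>

text \<open>This gives the uniqueness behind the definite description in \<open>H_alg\<close>:
  without any Folner net every number would satisfy it vacuously. Cubes of side n work because a
  translate by \<open>g\<close> misses at most the proportion 1 - prod (1 - |g_i|/n) once n is
  large.\<close>

lemma ex_folner_net_int_vec: "\<exists>N. right_folner_net (\<lambda>F. F :: (int ^ 'd) set) N"
proof -
  define Q :: "nat \<Rightarrow> (int ^ 'd) set" where "Q n = {x. \<forall>i. x $ i \<in> {0..<int n}}" for n
  have finQ: "finite (Q n)" for n unfolding Q_def by (rule finite_vec_box) simp
  have cardQ: "card (Q n) = n ^ CARD('d)" for n unfolding Q_def card_vec_box by simp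
  have lim: "(\<lambda>n. real (card ((\<lambda>x. x + g) ` Q n - Q n)) / real (card (Q n))) \<longlonglongrightarrow> 0" for g
  proof -
    \<comment> \<open>\<open>P n\<close> is the overlap of the cube with its translate, a box with
      sides n - |g_i|; \<open>nat\<close> in the next formula covers the case where this is
      negative.\<close>
    define P where "P n = {x :: int ^ 'd. \<forall>i. x $ i \<in> {max 0 (g $ i)..<int n + min 0 (g $ i)}}" for n
    have cardP: "card (P n) = (\<Prod>i\<in>UNIV. nat (int n - \<bar>g $ i\<bar>))" for n
      unfolding P_def card_vec_box
      by (intro prod.cong refl) (auto simp: max_def min_def)
    have sub: "P n \<subseteq> (\<lambda>x. x + g) ` Q n" "P n \<subseteq> Q n" for n
    proof
      fix x assume x: "x \<in> P n"
      have "x - g \<in> Q n"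
        unfolding Q_def
      proof safe
        fix i
        have "x $ i \<in> {max 0 (g $ i)..<int n + min 0 (g $ i)}" using x by (simp add: P_def)
        then show "(x - g) $ i \<in> {0..<int n}" by auto
      qed
      then show "x \<in> (\<lambda>x. x + g) ` Q n" by (intro image_eqI[of _ _ "x - g"]) auto
    next
      show "P n \<subseteq> Q n"
      proof
        fix x assume x: "x \<in> P n"
        have "x $ i \<in> {0..<int n}" for i
        proof -
          have "x $ i \<in> {max 0 (g $ i)..<int n + min 0 (g $ i)}" using x by (simp add: P_def)
          then show ?thesis by auto
        qed
        then show "x \<in> Q n" by (simp add: Q_def)
      qed
    qed
    have le: "real (card ((\<lambda>x. x + g) ` Q n - Q n)) \<le> real (card (Q n)) - real (card (P n))" for n
    proof -
      have "card ((\<lambda>x. x + g) ` Q n - Q n) \<le> card ((\<lambda>x. x + g) ` Q n - P n)"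
        using sub finQ by (intro card_mono) auto
      also have "\<dots> = card ((\<lambda>x. x + g) ` Q n) - card (P n)"
        using finite_subset[OF sub(2) finQ] sub(1) by (rule card_Diff_subset)
      also have "card ((\<lambda>x. x + g) ` Q n) = card (Q n)" by (intro card_image) (simp add: inj_on_def)
      finally show ?thesis using card_mono[OF finQ sub(2)[of n]] by linarith
    qed
    have "(\<lambda>n. \<Prod>i\<in>(UNIV :: 'd set). real (nat (int n - \<bar>g $ i\<bar>)) / real n) \<longlonglongrightarrow> (\<Prod>i\<in>(UNIV :: 'd set). 1)"
    proof (rule tendsto_prod)
      fix i
      have "(\<lambda>n. 1 - real_of_int \<bar>g $ i\<bar> / real n) \<longlonglongrightarrow> 1 - 0"
        by (intro tendsto_intros lim_const_over_n)
      moreover have "\<forall>\<^sub>F n in sequentially. 1 - real_of_int \<bar>g $ i\<bar> / real n = real (nat (int n - \<bar>g $ i\<bar>)) / real n"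
        \<comment> \<open>From here on the truncation by \<open>nat\<close> is inactive; the added 1
          also excludes division by n = 0 when g_i = 0.\<close>
        using eventually_ge_at_top[of "nat \<bar>g $ i\<bar> + 1"]
        by eventually_elim (auto simp: field_simps of_nat_diff)
      ultimately show "(\<lambda>n. real (nat (int n - \<bar>g $ i\<bar>)) / real n) \<longlonglongrightarrow> 1"
        by (simp add: Lim_transform_eventually)
    qed
    then have "(\<lambda>n. 1 - (\<Prod>i\<in>(UNIV :: 'd set). real (nat (int n - \<bar>g $ i\<bar>)) / real n)) \<longlonglongrightarrow> 1 - 1"
      by (intro tendsto_intros) simp
    then have lim: "(\<lambda>n. 1 - (\<Prod>i\<in>(UNIV :: 'd set). real (nat (int n - \<bar>g $ i\<bar>)) / real n)) \<longlonglongrightarrow> 0"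
      by simp
    show ?thesis
    proof (rule tendsto_sandwich[OF _ _ tendsto_const lim])
      show "\<forall>\<^sub>F n in sequentially. real (card ((\<lambda>x. x + g) ` Q n - Q n)) / real (card (Q n))
          \<le> 1 - (\<Prod>i\<in>UNIV. real (nat (int n - \<bar>g $ i\<bar>)) / real n)"
        using eventually_gt_at_top[of 0]
      proof eventually_elim
        case (elim n)
        have "(\<Prod>i\<in>UNIV. real (nat (int n - \<bar>g $ i\<bar>)) / real n) = real (card (P n)) / real (card (Q n))"
          by (simp add: cardP cardQ prod_dividef)
        moreover have "real (card (Q n)) > 0" using elim by (simp add: cardQ)
        ultimately show ?case using le[of n] by (simp add: field_simps)
      qed
    qed simp
  qed
  have "right_folner_net Q sequentially"
    unfolding right_folner_net_def
  proof (intro conjI allI lim)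
    show "\<forall>\<^sub>F n in sequentially. finite (Q n) \<and> Q n \<noteq> {}"
      using eventually_gt_at_top[of 0]
    proof eventually_elim
      case (elim n)
      then have "card (Q n) \<noteq> 0" by (simp add: cardQ)
      then show ?case using finQ by auto
    qed
  qed simp
  then have "right_folner_net (\<lambda>F. F) (filtermap Q sequentially)"
    by (simp add: right_folner_net_filtermap)
  then show ?thesis ..
qed

section \<open>Trajectories under disjoint unions and translations\<close>

lemma trajectory_Un:
  assumes "finite F" "finite F'" "F \<inter> F' = {}"
  shows "trajectory \<alpha> X (F \<union> F') = trajectory \<alpha> X F + trajectory \<alpha> X F'"
  using assms by (simp add: trajectory_def sum.union_disjoint)

lemma finite_trajectory:
  assumes "finite X" "finite F"
  shows "finite (trajectory \<alpha> X F)"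
  using assms(2) unfolding trajectory_def
  by (induction F rule: finite_induct) (auto simp: assms(1) intro: finite_set_plus)

lemma trajectory_nonempty:
  assumes "X \<noteq> {}"
  shows "trajectory \<alpha> X F \<noteq> {}"
\<comment> \<open>For infinite \<open>F\<close> the sum takes its default value, the set
  \<open>{0}\<close>, which is non-empty.\<close>
proof (cases "finite F")
  case True
  then show ?thesis unfolding trajectory_def
    by (induction F rule: finite_induct) (use assms in \<open>auto simp: set_plus_def\<close>)
qed (simp add: trajectory_def)

lemma card_trajectory_pos:
  assumes "finite X" "X \<noteq> {}" "finite F"
  shows "card (trajectory \<alpha> X F) > 0"
  using finite_trajectory[OF assms(1,3), of \<alpha>] trajectory_nonempty[OF assms(2), of \<alpha> F]
  by (simp add: card_gt_0_iff)

lemma trajectory_subset: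
  assumes "additive_subgroup_set A" "left_action_on A \<alpha>" "X \<subseteq> A" "finite F"
  shows "trajectory \<alpha> X F \<subseteq> A"
  using assms(4) unfolding trajectory_def
proof (induction F rule: finite_induct)
  case empty
  then show ?case using assms(1) by (simp add: additive_subgroup_set_def)
next
  case (insert g F)
  have "\<alpha> g ` X \<subseteq> A" using assms(2,3) by (auto simp: left_action_on_def)
  then show ?case using insert assms(1)
    by (auto simp: additive_subgroup_set_def elim!: set_plus_elim)
qed

text \<open>\<open>\<alpha> t\<close> can be pulled out of the Minkowski sum because it is additive
  on \<open>A\<close> and all the sets involved lie in \<open>A\<close>. As an image, the translated
  trajectory has no more elements than the original.\<close>

lemma trajectory_shift:
  assumes A: "additive_subgroup_set A" and \<alpha>: "left_action_on A \<alpha>" and X: "X \<subseteq> A"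
    and "finite F"
  shows "trajectory \<alpha> X ((+) t ` F) = \<alpha> t ` trajectory \<alpha> X F"
  using assms(4)
proof (induction F rule: finite_induct)
  case empty
  have "0 \<in> A" using A by (simp add: additive_subgroup_set_def)
  then have "\<alpha> t (0 + 0) = \<alpha> t 0 + \<alpha> t 0" using \<alpha> by (simp only: left_action_on_def)
  then show ?case by (simp add: trajectory_def)
next
  case (insert g F)
  have plus: "\<alpha> t ` (S + T) = \<alpha> t ` S + \<alpha> t ` T" if "S \<subseteq> A" "T \<subseteq> A" for S T
  proof -
    have eq: "\<alpha> t (x + y) = \<alpha> t x + \<alpha> t y" if "x \<in> S" "y \<in> T" for x y
      using \<alpha> subsetD[OF \<open>S \<subseteq> A\<close> that(1)] subsetD[OF \<open>T \<subseteq> A\<close> that(2)]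
      by (simp add: left_action_on_def)
    show ?thesis
    proof
      show "\<alpha> t ` (S + T) \<subseteq> \<alpha> t ` S + \<alpha> t ` T" by (auto elim!: set_plus_elim simp: eq intro!: set_plus_intro)
      show "\<alpha> t ` S + \<alpha> t ` T \<subseteq> \<alpha> t ` (S + T)"
        by (auto elim!: set_plus_elim simp: eq[symmetric] intro!: imageI set_plus_intro)
    qed
  qed
  have "\<alpha> (t + g) ` X = \<alpha> t ` \<alpha> g ` X"
    using \<alpha> X by (auto simp: left_action_on_def image_image intro!: image_cong)
  moreover have "\<alpha> g ` X \<subseteq> A" using \<alpha> X by (auto simp: left_action_on_def)
  ultimately show ?case
    using insert plus[OF _ trajectory_subset[OF A \<alpha> X insert(1)], of "\<alpha> g ` X"]
    by (simp add: trajectory_def image_iff)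
qed

section \<open>Height growth along powers of a generator\<close>

text \<open>\<open>D\<close> and \<open>K\<close> depend on \<open>g\<close> alone and not on the
  box, which is what allows iteration.\<close>

lemma action_height_box:
  fixes A :: "(rat ^ 'n) set" and \<alpha> :: "'g::group_add \<Rightarrow> rat ^ 'n \<Rightarrow> rat ^ 'n"
  assumes "additive_subgroup_set A" "left_action_on A \<alpha>"
  obtains D K where "D > 0" "K \<ge> 0"
    "\<And>N c x. x \<in> A \<Longrightarrow> x \<in> height_box N c \<Longrightarrow> \<alpha> g x \<in> height_box (N * D) (K * c)"
proof -
  obtain M where M: "\<And>x. x \<in> A \<Longrightarrow> \<alpha> g x = M *v x"
    using additive_on_eq_matrix[of A "\<alpha> g"] assms by (auto simp: left_action_on_def)
  obtain D K where "D > 0" "K \<ge> 0"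
    "\<And>N c x. x \<in> height_box N c \<Longrightarrow> M *v x \<in> height_box (N * D) (K * c)"
    by (rule matrix_height_box[of M]) blast
  with M show ?thesis using that by metis
qed

text \<open>All powers up to \<open>k\<close> land in one box, so that they can be summed over a
  tile. A power below \<open>k\<close> is padded by refining the denominator by \<open>D\<close>, at
  the cost of a factor \<open>D\<close> in the numerators; \<open>D \<le> K\<close> keeps this
  within the bound.\<close>

lemma axis_power_height_box:
  fixes A :: "(rat ^ 'n) set" and \<alpha> :: "int ^ 'd \<Rightarrow> rat ^ 'n \<Rightarrow> rat ^ 'n"
  assumes \<alpha>: "left_action_on A \<alpha>" and D: "D > 0" "D \<le> K"
    and step: "\<And>N c x. c \<ge> 0 \<Longrightarrow> x \<in> A \<Longrightarrow> x \<in> height_box N c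
      \<Longrightarrow> \<alpha> (axis a 1) x \<in> height_box (N * D) (K * c)"
    and x: "x \<in> A" "x \<in> height_box N c" and c: "c \<ge> 0" and "i \<le> k"
  shows "\<alpha> (axis a (int i)) x \<in> height_box (N * D ^ k) (K ^ k * c)"
  using \<open>i \<le> k\<close>
proof (induction k arbitrary: i)
  case 0
  have "axis a 0 = (0 :: int ^ 'd)" by (simp add: axis_def vec_eq_iff)
  then have "\<alpha> (axis a 0) x = x" using x \<alpha> by (simp only: left_action_on_def)
  then show ?case using 0 x by simp
next
  case (Suc k)
  have pos: "K ^ k * c \<ge> 0" using c D by simp
  show ?case
  proof (cases "i = Suc k")
    case True
    have "axis a (int (Suc k)) = axis a 1 + axis a (int k)"
      by (simp add: axis_def vec_eq_iff)
    then have "\<alpha> (axis a (int i)) x = \<alpha> (axis a 1) (\<alpha> (axis a (int k)) x)"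
      using \<alpha> x True by (simp add: left_action_on_def)
    moreover have "\<alpha> (axis a (int k)) x \<in> A" using \<alpha> x by (simp add: left_action_on_def)
    ultimately show ?thesis using step[OF pos _ Suc.IH[of k]] by (simp add: algebra_simps)
  next
    case False
    then have "\<alpha> (axis a (int i)) x \<in> height_box (N * D ^ k) (K ^ k * c)" using Suc by simp
    moreover have "D * (K ^ k * c) \<le> K ^ Suc k * c"
      using mult_right_mono[OF D(2) pos] by (simp add: mult.assoc)
    ultimately have "\<alpha> (axis a (int i)) x \<in> height_box (N * D ^ k * D) (K ^ Suc k * c)"
      by (rule height_box_mono[OF _ D(1)])
    then show ?thesis by (simp add: mult.assoc power_commutes)
  qed
qed

section \<open>Square tiles and the size of their trajectories\<close>

definition square_tile :: "'d \<Rightarrow> 'd \<Rightarrow> nat \<Rightarrow> (int ^ 'd) set" where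
  "square_tile a b k = {x. \<forall>i. x $ i \<in> (if i = a \<or> i = b then {0..<int k} else {0})}"

lemma finite_square_tile: "finite (square_tile a b k)"
  unfolding square_tile_def by (rule finite_vec_box) simp

lemma card_square_tile:
  assumes "a \<noteq> b"
  shows "card (square_tile a b k :: (int ^ 'd) set) = k\<^sup>2"
proof -
  have "card (square_tile a b k :: (int ^ 'd) set) = (\<Prod>i\<in>UNIV. if i = a \<or> i = b then k else 1)"
    unfolding square_tile_def card_vec_box by (intro prod.cong) auto
  also have "\<dots> = (\<Prod>i\<in>{a, b}. k)"
    by (rule prod.mono_neutral_cong_right) auto
  finally show ?thesis using assms by (simp add: power2_eq_square)
qed

text \<open>\<open>p\<close> rounds the coordinates \<open>a\<close> and \<open>b\<close> down to
  multiples of \<open>k\<close> and keeps the others, so the flat squares partition each plane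
  parallel to these two directions, and hence the whole group.\<close>

lemma square_tile_tiles:
  fixes a b :: "'d::finite" and k :: nat
  assumes "k > 0"
  obtains p :: "int ^ 'd \<Rightarrow> int ^ 'd"
  where "\<And>g. g - p g \<in> square_tile a b k"
    "\<And>g x. x \<in> square_tile a b k \<Longrightarrow> p (p g + x) = p g"
proof -
  define p :: "int ^ 'd \<Rightarrow> int ^ 'd" where
    "p g = (\<chi> i. if i = a \<or> i = b then g $ i div int k * int k else g $ i)" for g
  have "g - p g \<in> square_tile a b k" for g
    using assms by (auto simp: square_tile_def p_def minus_div_mult_eq_mod)
  moreover have "p (p g + x) = p g" if "x \<in> square_tile a b k" for g x
  proof -
    have "p (p g + x) $ i = p g $ i" for i
    proof -
      have "x $ i \<in> (if i = a \<or> i = b then {0..<int k} else {0})"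
        using that by (simp add: square_tile_def)
      then show ?thesis using assms by (auto simp: p_def split: if_splits)
    qed
    then show ?thesis by (simp add: vec_eq_iff)
  qed
  ultimately show ?thesis by (rule that)
qed

text \<open>The denominator also grows exponentially in \<open>k\<close> but does not enter the
  count of a box. Numerators are bounded by \<open>k^2 * K^(2k) * c\<close>: the factor
  \<open>k^2\<close> yields the logarithmic term and \<open>K^(2k)\<close> the linear one.\<close>

lemma ln_card_trajectory_square_tile:
  fixes A :: "(rat ^ 'n) set" and \<alpha> :: "int ^ 'd \<Rightarrow> rat ^ 'n \<Rightarrow> rat ^ 'n"
  assumes A: "additive_subgroup_set A" and \<alpha>: "left_action_on A \<alpha>"
    and X: "X \<subseteq> A" "finite X" "X \<noteq> {}" and ab: "a \<noteq> b"
  obtains C L where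
    "\<And>k. k > 0 \<Longrightarrow> ln (real (card (trajectory \<alpha> X (square_tile a b k))))
      \<le> C + 2 * real CARD('n) * ln (real k) + L * real k"
proof -
  obtain D1 K1 where 1: "D1 > 0" "K1 \<ge> 0"
    "\<And>N c x. x \<in> A \<Longrightarrow> x \<in> height_box N c \<Longrightarrow> \<alpha> (axis a 1) x \<in> height_box (N * D1) (K1 * c)"
    by (rule action_height_box[OF A \<alpha>]) blast
  obtain D2 K2 where 2: "D2 > 0" "K2 \<ge> 0"
    "\<And>N c x. x \<in> A \<Longrightarrow> x \<in> height_box N c \<Longrightarrow> \<alpha> (axis b 1) x \<in> height_box (N * D2) (K2 * c)"
    by (rule action_height_box[OF A \<alpha>]) blast
  \<comment> \<open>One pair of constants has to serve both generators. \<open>D\<close> is a common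
    denominator factor, and the three summands of \<open>K\<close> cover the padding by
    \<open>D\<close> and the two numerator bounds after passing to it.\<close>
  define D where "D = D1 * D2"
  define K where "K = D + D2 * K1 + D1 * K2"
  have D: "D > 0" "D \<le> K" using 1(1,2) 2(1,2) by (auto simp: D_def K_def)
  have K: "K \<ge> 1" using D by linarith
  have stepa: "\<alpha> (axis a 1) x \<in> height_box (N * D) (K * c)"
    if "c \<ge> 0" "x \<in> A" "x \<in> height_box N c" for N c x
  proof -
    have "D2 * K1 \<le> K" using 1(1,2) 2(1,2) D(1) by (simp add: K_def)
    then have "D2 * (K1 * c) \<le> K * c"
      using mult_right_mono[OF _ that(1)] by (metis mult.assoc)
    from height_box_mono[OF 1(3)[OF that(2,3)] 2(1) this] show ?thesis
      by (simp add: D_def mult.assoc)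
  qed
  have stepb: "\<alpha> (axis b 1) x \<in> height_box (N * D) (K * c)"
    if "c \<ge> 0" "x \<in> A" "x \<in> height_box N c" for N c x
  proof -
    have "D1 * K2 \<le> K" using 1(1,2) 2(1,2) D(1) by (simp add: K_def)
    then have "D1 * (K2 * c) \<le> K * c"
      using mult_right_mono[OF _ that(1)] by (metis mult.assoc)
    from height_box_mono[OF 2(3)[OF that(2,3)] 1(1) this] show ?thesis
      by (simp add: D_def mult.commute mult.left_commute)
  qed
  obtain N c where N: "N > 0" and c: "c > 0" and XN: "X \<subseteq> height_box N c"
    by (rule finite_subset_height_box[OF X(2)])
  have "ln (real (card (trajectory \<alpha> X (square_tile a b k))))
      \<le> real CARD('n) * ln (3 * real_of_int c) + 2 * real CARD('n) * ln (real k)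
        + 2 * real CARD('n) * ln (real_of_int K) * real k" if k: "k > 0" for k
  proof -
    let ?B = "square_tile a b k :: (int ^ 'd) set"
    \<comment> \<open>There are \<open>k^2\<close> summands, and each has undergone up to
      \<open>k\<close> steps along either axis.\<close>
    let ?c = "int (k\<^sup>2) * (K ^ k * (K ^ k * c))"
    have "\<alpha> g ` X \<subseteq> height_box (N * D ^ k * D ^ k) (K ^ k * (K ^ k * c))" if g: "g \<in> ?B" for g
    proof
      fix y assume "y \<in> \<alpha> g ` X"
      then obtain x where x: "x \<in> X" "y = \<alpha> g x" by blast
      have gi: "g $ i \<in> (if i = a \<or> i = b then {0..<int k} else {0})" for i
        using g by (simp add: square_tile_def)
      define i j where "i = nat (g $ a)" and "j = nat (g $ b)"
      have ij: "i \<le> k" "j \<le> k" using gi[of a] gi[of b] by (auto simp: i_def j_def)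
      have "g = axis a (int i) + axis b (int j)"
        unfolding vec_eq_iff
      proof
        fix l
        show "g $ l = (axis a (int i) + axis b (int j)) $ l"
          using gi[of l] ab by (auto simp: axis_def i_def j_def split: if_splits)
      qed
      then have y: "y = \<alpha> (axis a (int i)) (\<alpha> (axis b (int j)) x)"
        using \<alpha> x X by (auto simp: left_action_on_def)
      have xA: "x \<in> A" and xN: "x \<in> height_box N c" using x X XN by auto
      have "\<alpha> (axis b (int j)) x \<in> height_box (N * D ^ k) (K ^ k * c)"
        by (rule axis_power_height_box[OF \<alpha> D _ xA xN _ ij(2)], rule stepb, assumption+)
          (use c in simp)
      moreover have "\<alpha> (axis b (int j)) x \<in> A" using \<alpha> xA by (simp add: left_action_on_def)
      ultimately show "y \<in> height_box (N * D ^ k * D ^ k) (K ^ k * (K ^ k * c))"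
        unfolding y
        by (intro axis_power_height_box[OF \<alpha> D _ _ _ _ ij(1)], intro stepa) (use c K in simp_all)
    qed
    then have sub: "trajectory \<alpha> X ?B \<subseteq> height_box (N * D ^ k * D ^ k) ?c"
      unfolding trajectory_def card_square_tile[OF ab, of k, symmetric]
      by (intro height_box_sum finite_square_tile)
    have N0: "N * D ^ k * D ^ k \<noteq> 0" using N D by simp
    have "?c > 0" using k K c by simp
    then have c0: "?c \<ge> 1" and c3: "0 \<le> 3 * ?c" by linarith+
    have "card (trajectory \<alpha> X ?B) \<le> card (height_box (N * D ^ k * D ^ k) ?c :: (rat ^ 'n) set)"
      by (rule card_mono[OF finite_height_box[OF N0] sub])
    also have "\<dots> \<le> nat (2 * ?c + 1) ^ CARD('n)" by (rule card_height_box[OF N0])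
    \<comment> \<open>Since \<open>?c \<ge> 1\<close>, the 1 is absorbed and the bound becomes a
      product, whose logarithm splits.\<close>
    also have "\<dots> \<le> nat (3 * ?c) ^ CARD('n)"
      using c0 by (intro power_mono nat_mono) linarith+
    finally have "real (card (trajectory \<alpha> X ?B)) \<le> real (nat (3 * ?c) ^ CARD('n))"
      by (simp only: of_nat_le_iff)
    also have "\<dots> = real_of_int (3 * ?c) ^ CARD('n)"
      by (subst of_nat_power, subst of_nat_nat[OF c3]) (rule refl)
    finally have "real (card (trajectory \<alpha> X ?B)) \<le> real_of_int (3 * ?c) ^ CARD('n)" .
    moreover have "card (trajectory \<alpha> X ?B) > 0"
      by (rule card_trajectory_pos[OF X(2,3) finite_square_tile])
    ultimately have "ln (real (card (trajectory \<alpha> X ?B))) \<le> ln (real_of_int (3 * ?c) ^ CARD('n))"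
      by (intro ln_mono) simp_all
    also have "\<dots> = real CARD('n) * ln (real_of_int (3 * ?c))" by (intro ln_realpow)
    also have "real_of_int (3 * ?c) = 3 * real_of_int c * (real k ^ 2 * real_of_int K ^ (2 * k))"
      by (simp add: power_add mult_2)
    also have "ln \<dots> = ln (3 * real_of_int c) + (2 * ln (real k) + 2 * real k * ln (real_of_int K))"
      using k K c by (simp add: ln_mult_pos ln_realpow)
    finally show ?thesis by (simp add: algebra_simps)
  qed
  then show ?thesis by (rule that)
qed

section \<open>Vanishing of the limit and of the entropy\<close>

lemma folner_limit_trajectory:
  fixes A :: "(rat ^ 'n) set" and \<alpha> :: "int ^ 'd \<Rightarrow> rat ^ 'n \<Rightarrow> rat ^ 'n"
  assumes A: "additive_subgroup_set A" and \<alpha>: "left_action_on A \<alpha>" and d: "CARD('d) > 1"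
    and X: "X \<subseteq> A" "finite X" "X \<noteq> {}" and N: "right_folner_net (\<lambda>F. F) N"
  shows "((\<lambda>F. ln (real (card (trajectory \<alpha> X F))) / real (card F)) \<longlongrightarrow> 0) N"
proof (rule folner_limit_zero[OF N])
  have pos: "card (trajectory \<alpha> X F) > 0" if "finite F" for F
    by (rule card_trajectory_pos[OF X(2,3) that])
  show "0 \<le> ln (real (card (trajectory \<alpha> X F)))" if "finite F" for F
    using pos[OF that] by simp
  show "ln (real (card (trajectory \<alpha> X {}))) \<le> 0" by (simp add: trajectory_def)
  show "ln (real (card (trajectory \<alpha> X (F \<union> F'))))
      \<le> ln (real (card (trajectory \<alpha> X F))) + ln (real (card (trajectory \<alpha> X F')))"
    if F: "finite F" "finite F'" "F \<inter> F' = {}" for F F'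
  proof -
    have "real (card (trajectory \<alpha> X (F \<union> F')))
        \<le> real (card (trajectory \<alpha> X F)) * real (card (trajectory \<alpha> X F'))"
      using card_set_plus_le[OF finite_trajectory[OF X(2) F(1)] finite_trajectory[OF X(2) F(2)]]
      by (metis trajectory_Un[OF F] of_nat_le_iff of_nat_mult)
    moreover have "finite (F \<union> F')" using F by simp
    ultimately show ?thesis using pos F by (simp flip: ln_mult_pos)
  qed
  show "ln (real (card (trajectory \<alpha> X ((+) t ` F)))) \<le> ln (real (card (trajectory \<alpha> X F)))"
    if "finite F" for F t
    using pos[of F] pos[of "(+) t ` F"] that card_image_le[OF finite_trajectory[OF X(2) that]]
    by (simp add: trajectory_shift[OF A \<alpha> X(1)])
  fix e :: real assume e: "e > 0"
  \<comment> \<open>Here d > 1 provides two different directions for the squares.\<close>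
  obtain a b :: 'd where ab: "a \<noteq> b"
    using d card_le_Suc0_iff_eq[of "UNIV :: 'd set"] by auto
  obtain C L where CL: "\<And>k. k > 0 \<Longrightarrow> ln (real (card (trajectory \<alpha> X (square_tile a b k))))
      \<le> C + 2 * real CARD('n) * ln (real k) + L * real k"
    by (rule ln_card_trajectory_square_tile[OF A \<alpha> X ab]) blast
  have inv: "(\<lambda>k. 1 / real k) \<longlonglongrightarrow> 0" by (rule lim_const_over_n)
  have "(\<lambda>k. (1 / real k) * (1 / real k)) \<longlonglongrightarrow> 0 * 0"
    and "(\<lambda>k. (ln (real k) / real k) * (1 / real k)) \<longlonglongrightarrow> 0 * 0"
    by (intro tendsto_mult inv lim_ln_over_n)+
  then have lims: "(\<lambda>k. 1 / real k ^ 2) \<longlonglongrightarrow> 0" "(\<lambda>k. ln (real k) / real k ^ 2) \<longlonglongrightarrow> 0"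
    by (simp_all add: power2_eq_square)
  \<comment> \<open>The estimate divided by the area of the square: the linear term turns into
    \<open>L / k\<close> and so vanishes too.\<close>
  have "(\<lambda>k. C * (1 / real k ^ 2) + 2 * real CARD('n) * (ln (real k) / real k ^ 2) + L * (1 / real k))
      \<longlonglongrightarrow> C * 0 + 2 * real CARD('n) * 0 + L * 0"
    by (intro tendsto_add tendsto_mult tendsto_const inv lims)
  then have "\<forall>\<^sub>F k in sequentially.
      C * (1 / real k ^ 2) + 2 * real CARD('n) * (ln (real k) / real k ^ 2) + L * (1 / real k) < e"
    using e by (intro order_tendstoD(2)) auto
  then obtain k where k: "k > 0"
    "C * (1 / real k ^ 2) + 2 * real CARD('n) * (ln (real k) / real k ^ 2) + L * (1 / real k) < e"
    using eventually_happens'[OF sequentially_bot eventually_conj[OF eventually_gt_at_top[of 0]]]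
    by blast
  have "ln (real (card (trajectory \<alpha> X (square_tile a b k)))) / real k ^ 2
      \<le> (C + 2 * real CARD('n) * ln (real k) + L * real k) / real k ^ 2"
    using CL[OF k(1)] by (intro divide_right_mono) auto
  also have "\<dots> = C * (1 / real k ^ 2) + 2 * real CARD('n) * (ln (real k) / real k ^ 2) + L * (1 / real k)"
    using k(1) by (simp add: add_divide_distrib power2_eq_square)
  finally have small: "ln (real (card (trajectory \<alpha> X (square_tile a b k)))) / real (card (square_tile a b k)) < e"
    using k(2) card_square_tile[OF ab, of k] by simp
  have "square_tile a b k \<noteq> {}"
    using card_square_tile[OF ab, of k] k(1) by auto
  obtain p where p: "\<And>g. g - p g \<in> square_tile a b k"
    "\<And>g x. x \<in> square_tile a b k \<Longrightarrow> p (p g + x) = p g"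
    by (rule square_tile_tiles[OF k(1)]) blast
  show "\<exists>B p. finite B \<and> B \<noteq> {} \<and>
      ln (real (card (trajectory \<alpha> X B))) / real (card B) < e \<and>
      (\<forall>g. g - p g \<in> B) \<and> (\<forall>g. \<forall>x\<in>B. p (p g + x) = p g)"
    using small finite_square_tile \<open>square_tile a b k \<noteq> {}\<close> p
    by (intro exI[of _ "square_tile a b k"] exI[of _ p]) simp
qed

theorem corollary5p16:
  fixes A :: "(rat ^ 'n) set"
    and \<alpha> :: "int ^ 'd \<Rightarrow> rat ^ 'n \<Rightarrow> rat ^ 'n"
  assumes "additive_subgroup_set A"
    and "left_action_on A \<alpha>"
    and "CARD('d) > 1"
  shows "h_alg A \<alpha> = 0"
proof -
  have zero: "H_alg \<alpha> X = 0" if X: "X \<subseteq> A" "finite X" "X \<noteq> {}" for X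
    unfolding H_alg_def
  proof (rule the_equality)
    show lim: "\<forall>N. right_folner_net (\<lambda>F. F) N \<longrightarrow>
        ((\<lambda>F. ln (real (card (trajectory \<alpha> X F))) / real (card F)) \<longlongrightarrow> 0) N"
      using folner_limit_trajectory[OF assms] X by blast
    fix L assume L: "\<forall>N. right_folner_net (\<lambda>F. F) N \<longrightarrow>
        ((\<lambda>F. ln (real (card (trajectory \<alpha> X F))) / real (card F)) \<longlongrightarrow> L) N"
    obtain N :: "(int ^ 'd) set filter" where N: "right_folner_net (\<lambda>F. F) N"
      using ex_folner_net_int_vec by blast
    then have "N \<noteq> bot" by (simp add: right_folner_net_def)
    then show "L = 0" using tendsto_unique L lim N by blast
  qed
  show ?thesis
    unfolding h_alg_def
  proof (rule SUP_eqI)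
    fix y :: ereal
    assume y: "\<And>X. X \<in> {X. X \<subseteq> A \<and> finite X \<and> X \<noteq> {}} \<Longrightarrow> ereal (H_alg \<alpha> X) \<le> y"
    \<comment> \<open>The supremum of an empty family of extended reals would be minus infinity;
      \<open>{0}\<close> shows that the family is non-empty.\<close>
    have "{0} \<subseteq> A" using assms(1) by (simp add: additive_subgroup_set_def)
    with y[of "{0}"] zero[of "{0}"] show "0 \<le> y" by (simp add: zero_ereal_def)
  qed (use zero in \<open>auto simp: zero_ereal_def\<close>)
qed

end
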